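(* Let $W$ be a radial weight with $m_0=1$ and let $R>0$. Suppose that there is a Borel probability measure $\nu$ supported on $[R^2,\infty)$ such that for every integer $k\ge1$, $$\int t^k\,d\nu(t)\ \ge\ m_k\qquad\text{and}\qquad R^2\int t^{k-1}\,d\nu(t)\ \le\ m_k.$$ Then $R$ is admissible for $F^2_W$.
   Context: A radial weight is a measurable function $W\ge0$ on $[0,\infty)$, not almost everywhere zero, whose moments $m_k=\int_0^\infty t^kW(t)\,dt$, $k=0,1,2,\dots$, are all finite. $F^2_W$ is the space of entire functions $f$ with $\|f\|_W^2=\frac1\pi\int_{\mathbb C}|f(z)|^2W(|z|^2)\,dA(z)<\infty$, where $dA$ is area measure on $\mathbb C$. A radius $R>0$ is admissible for $F^2_W$ if $\|f\|_W\le\|g\|_W$ for all $f,g\in F^2_W$ with $|f(z)|\le|g(z)|$ for $|z|>R$. *)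

theory Defs
  imports "HOL-Complex_Analysis.Complex_Analysis" "HOL-Probability.Probability"
begin

definition weight_moment :: "(real \<Rightarrow> real) \<Rightarrow> nat \<Rightarrow> real" where
  "weight_moment W k = (LINT t|lebesgue_on {0..}. t ^ k * W t)"

text \<open>
  A weight is a function on $[0,\infty)$; its values at negative arguments are never used.
\<close>

definition radial_weight :: "(real \<Rightarrow> real) \<Rightarrow> bool" where
  "radial_weight W \<longleftrightarrow>
     W \<in> borel_measurable (lebesgue_on {0..}) \<and>
     (\<forall>t\<ge>0. 0 \<le> W t) \<and>
     \<not> (AE t in lebesgue_on {0..}. W t = 0) \<and>
     (\<forall>k. integrable (lebesgue_on {0..}) (\<lambda>t. t ^ k * W t))"

definition fock_space :: "(real \<Rightarrow> real) \<Rightarrow> (complex \<Rightarrow> complex) set" where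
  "fock_space W =
     {f. f holomorphic_on UNIV \<and>
         integrable lebesgue (\<lambda>z. (cmod (f z))\<^sup>2 * W ((cmod z)\<^sup>2))}"

definition fock_norm :: "(real \<Rightarrow> real) \<Rightarrow> (complex \<Rightarrow> complex) \<Rightarrow> real" where
  "fock_norm W f =
     sqrt (1 / pi * (LINT z|lebesgue. (cmod (f z))\<^sup>2 * W ((cmod z)\<^sup>2)))"

definition admissible_radius :: "(real \<Rightarrow> real) \<Rightarrow> real \<Rightarrow> bool" where
  "admissible_radius W R \<longleftrightarrow>
     0 < R \<and>
     (\<forall>f\<in>fock_space W. \<forall>g\<in>fock_space W.
        (\<forall>z. R < cmod z \<longrightarrow> cmod (f z) \<le> cmod (g z)) \<longrightarrow>
        fock_norm W f \<le> fock_norm W g)"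

text \<open>
  Moments of a Borel measure, a priori possibly infinite.  The truncation of negative values
  by \<^const>\<open>ennreal\<close> is immaterial for measures supported on $[0,\infty)$.
\<close>

definition measure_moment :: "real measure \<Rightarrow> nat \<Rightarrow> ennreal" where
  "measure_moment \<nu> k = (\<integral>\<^sup>+ t. ennreal (t ^ k) \<partial>\<nu>)"

end

theory Submission
  imports Defs
begin

text \<open>
  Let $|f| \le |g|$ for $|z| > R$. The quotient $f/g$ extends holomorphically and boundedly to a
  neighbourhood of infinity; let $a$ be its value there, and put $u = g - \bar a f$,
  $v = f - a g$. Schwarz--Pick at infinity gives $|z||v| \le R|u|$ for $|z| \ge R$, and
  $|u|^2 - |v|^2 = (1-|a|^2)(|g|^2-|f|^2)$, so for $|a| < 1$ it suffices to show
  $\|v\|_W \le \|u\|_W$. With $n_k$ the moments of $\nu$, Parseval's identity on circles and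
  $R^2/t \le 1$ on the support of $\nu$ (needed for the term $k=0$) give
  \[ \sum_k |v_k|^2 m_k \le \sum_k |v_k|^2 n_k \le \sum_k |u_k|^2 \int R^2 t^{k-1}\,d\nu(t)
     \le |u_0|^2 + \sum_{k \ge 1} |u_k|^2 R^2 n_{k-1} \le \sum_k |u_k|^2 m_k. \]
\<close>

section \<open>Mean squares on circles\<close>

text \<open>Circles are parametrized as \<open>z * cis (2 * pi * x)\<close> with \<open>x\<close> in
  [0,1], which makes circle means expectations under a probability measure.\<close>

abbreviation unit_lborel :: "real measure" where
  "unit_lborel \<equiv> restrict_space lborel {0..1}"

lemma prob_space_unit_lborel: "prob_space unit_lborel"
  by (rule prob_space_restrict_space) auto

interpretation unit_lborel: prob_space unit_lborel
  by (rule prob_space_unit_lborel)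

lemma integrable_unit_lborel:
  fixes h :: "real \<Rightarrow> 'b::{banach, second_countable_topology}"
  assumes "continuous_on {0..1} h"
  shows "integrable unit_lborel h"
  using borel_integrable_compact[OF _ assms] by (simp add: integrable_restrict_space)

text \<open>For a nonzero frequency the antiderivative \<open>F\<close> is well defined and has
  period 1, so its increment over [0,1] vanishes.\<close>

lemma integral_cis_unit_lborel:
  assumes "k \<noteq> 0"
  shows "(LINT x|unit_lborel. cis (2 * pi * of_int k * x)) = 0"
proof -
  define F where "F = (\<lambda>x. cis (2 * pi * of_int k * x) / (\<i> * of_real (2 * pi * of_int k)))"
  have "(LINT x|unit_lborel. cis (2 * pi * of_int k * x)) =
        (LINT x|lborel. indicator {0..1} x *\<^sub>R cis (2 * pi * of_int k * x))"
    by (simp add: integral_restrict_space)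
  also have "\<dots> = F 1 - F 0"
  proof (rule integral_FTC_Icc)
    fix x :: real
    have "((\<lambda>z. exp (\<i> * (of_real (2 * pi * of_int k) * z)) / (\<i> * of_real (2 * pi * of_int k)))
        has_field_derivative exp (\<i> * (of_real (2 * pi * of_int k) * of_real x)))
        (at (of_real x))"
      using assms by (auto intro!: derivative_eq_intros)
    from has_vector_derivative_real_field[OF this]
    show "(F has_vector_derivative cis (2 * pi * of_int k * x)) (at x within {0..1})"
      by (simp add: F_def cis_conv_exp has_vector_derivative_at_within)
  qed (auto intro!: continuous_intros)
  also have "\<dots> = 0"
    by (simp add: F_def cis_multiple_2pi)
  finally show ?thesis .
qed

text \<open>Orthogonality of the characters, by induction on \<open>n\<close>: the new term
  contributes its own square and a cross term \<open>2 * Re (T x)\<close> of mean zero.\<close>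

lemma mean_square_trig_polynomial:
  fixes c :: "nat \<Rightarrow> complex"
  shows "(LINT x|unit_lborel. (cmod (\<Sum>k<n. c k * cis (2 * pi * real k * x)))\<^sup>2) =
         (\<Sum>k<n. (cmod (c k))\<^sup>2)"
proof (induction n)
  case (Suc n)
  define S where "S = (\<lambda>x. \<Sum>k<n. c k * cis (2 * pi * real k * x))"
  define T where "T = (\<lambda>x. \<Sum>k<n. c k * cnj (c n) * cis (2 * pi * of_int (int k - int n) * x))"
  have ex: "(cmod (\<Sum>k<Suc n. c k * cis (2 * pi * real k * x)))\<^sup>2 =
      (cmod (S x))\<^sup>2 + (cmod (c n))\<^sup>2 + 2 * Re (T x)" for x
  proof -
    have "T x = S x * cnj (c n * cis (2 * pi * real n * x))"
      unfolding T_def S_def sum_distrib_right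
      by (intro sum.cong refl)
        (simp add: cis_cnj cis_mult algebra_simps)
    moreover have "(cmod (a + b))\<^sup>2 = (cmod a)\<^sup>2 + (cmod b)\<^sup>2 + 2 * Re (a * cnj b)" for a b
      unfolding cmod_power2 by (simp add: power2_eq_square algebra_simps)
    ultimately show ?thesis
      unfolding S_def by (simp only: sum.lessThan_Suc norm_mult norm_cis mult_1_right)
  qed
  \<comment> \<open>Every frequency \<open>k - n\<close> with \<open>k < n\<close> is nonzero. It
    must stay a single integer cast, hence \<open>of_int_diff\<close> is removed from the
    simplifier.\<close>
  have T0: "(LINT x|unit_lborel. T x) = 0"
    unfolding T_def
    by (subst Bochner_Integration.integral_sum)
      (auto intro!: integrable_unit_lborel continuous_intros simp: integral_cis_unit_lborel
            simp del: of_int_diff)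
  have iT: "integrable unit_lborel T" and iS: "integrable unit_lborel (\<lambda>x. (cmod (S x))\<^sup>2)"
    unfolding T_def S_def by (auto intro!: integrable_unit_lborel continuous_intros)
  have "(LINT x|unit_lborel. Re (T x)) = 0"
    using T0 integral_Re[OF iT] by simp
  then show ?case
    unfolding ex using iS iT integrable_Re[OF iT] Suc.IH unit_lborel.prob_space
    by (simp add: S_def)
qed simp

text \<open>Absolute summability bounds all partial sums by the constant \<open>B\<close>, so
  dominated convergence carries the polynomial identity to the limit. The \<open>ennreal\<close>
  form lets later sums and integrals be interchanged freely.\<close>

lemma mean_square_trig_series:
  fixes c :: "nat \<Rightarrow> complex"
  assumes sm: "summable (\<lambda>k. cmod (c k))"
  shows "(\<integral>\<^sup>+x. ennreal ((cmod (\<Sum>k. c k * cis (2 * pi * real k * x)))\<^sup>2) \<partial>unit_lborel) =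
         (\<Sum>k. ennreal ((cmod (c k))\<^sup>2))"
proof -
  define S where "S = (\<lambda>n x. \<Sum>k<n. c k * cis (2 * pi * real k * x))"
  define F where "F = (\<lambda>x. \<Sum>k. c k * cis (2 * pi * real k * x))"
  define B where "B = (\<Sum>k. cmod (c k))"
  have lim: "(\<lambda>n. S n x) \<longlonglongrightarrow> F x" for x
    unfolding S_def F_def
    by (rule summable_LIMSEQ) (rule summable_norm_cancel, use sm in \<open>simp add: norm_mult\<close>)
  have bound: "cmod (S n x) \<le> B" for n x
  proof -
    have "cmod (S n x) \<le> (\<Sum>k<n. cmod (c k))"
      unfolding S_def by (rule order_trans[OF norm_sum]) (simp add: norm_mult)
    also have "\<dots> \<le> B"
      unfolding B_def by (rule sum_le_suminf[OF sm]) auto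
    finally show ?thesis .
  qed
  have [measurable]: "S n \<in> borel_measurable borel" for n
    unfolding S_def by (intro borel_measurable_continuous_onI continuous_intros)
  have [measurable]: "F \<in> borel_measurable borel"
    by (rule borel_measurable_LIMSEQ_metric[OF _ lim]) simp
  have mS: "(\<lambda>x. (cmod (S n x))\<^sup>2) \<in> borel_measurable unit_lborel" for n
    by (rule measurable_restrict_space1) simp
  have mF: "(\<lambda>x. (cmod (F x))\<^sup>2) \<in> borel_measurable unit_lborel"
    by (rule measurable_restrict_space1) simp
  have b2: "norm ((cmod (S n x))\<^sup>2) \<le> B\<^sup>2" for n x
    using bound[of n x] by (simp add: power_mono)
  have l2: "(\<lambda>n. (cmod (S n x))\<^sup>2) \<longlonglongrightarrow> (cmod (F x))\<^sup>2" for x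
    by (intro tendsto_intros lim)
  have dc1: "integrable unit_lborel (\<lambda>x. (cmod (F x))\<^sup>2)"
    by (rule integrable_dominated_convergence[where w = "\<lambda>_. B\<^sup>2" and s = "\<lambda>n x. (cmod (S n x))\<^sup>2", OF mF mS])
      (simp_all add: l2 b2 del: real_norm_def norm_power)
  have dc2: "(\<lambda>n. LINT x|unit_lborel. (cmod (S n x))\<^sup>2) \<longlonglongrightarrow>
      (LINT x|unit_lborel. (cmod (F x))\<^sup>2)"
    by (rule integral_dominated_convergence[where w = "\<lambda>_. B\<^sup>2", OF mF mS])
      (simp_all add: l2 b2 del: real_norm_def norm_power)
  have "(\<lambda>k. (cmod (c k))\<^sup>2) sums (LINT x|unit_lborel. (cmod (F x))\<^sup>2)"
    using dc2 unfolding sums_def S_def mean_square_trig_polynomial .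
  then have "(\<Sum>k. ennreal ((cmod (c k))\<^sup>2)) = ennreal (LINT x|unit_lborel. (cmod (F x))\<^sup>2)"
    by (intro suminf_ennreal_eq) auto
  also have "\<dots> = (\<integral>\<^sup>+x. ennreal ((cmod (F x))\<^sup>2) \<partial>unit_lborel)"
    using dc1 by (intro nn_integral_eq_integral[symmetric]) auto
  finally show ?thesis
    by (simp add: F_def)
qed

section \<open>Taylor coefficients of entire functions and Parseval's identity\<close>

definition taylor_coeff :: "(complex \<Rightarrow> complex) \<Rightarrow> nat \<Rightarrow> complex" where
  "taylor_coeff f k = (deriv ^^ k) f 0 / fact k"

lemma taylor_sums:
  assumes "f holomorphic_on UNIV"
  shows "(\<lambda>k. taylor_coeff f k * z ^ k) sums f z"
proof -
  have "f holomorphic_on ball 0 (norm z + 1)"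
    using assms holomorphic_on_subset by blast
  from holomorphic_power_series[OF this, of z] show ?thesis
    by (simp add: taylor_coeff_def)
qed

text \<open>A power series that converges at \<open>norm z + 1\<close> converges absolutely at every
  point of smaller modulus.\<close>

lemma summable_norm_taylor:
  assumes "f holomorphic_on UNIV"
  shows "summable (\<lambda>k. cmod (taylor_coeff f k * z ^ k))"
proof (rule powser_insidea)
  show "summable (\<lambda>k. taylor_coeff f k * of_real (norm z + 1) ^ k)"
    using taylor_sums[OF assms] sums_summable by blast
  have "norm (complex_of_real (norm z + 1)) = norm z + 1"
    unfolding norm_of_real by simp
  then show "norm z < norm (complex_of_real (norm z + 1))"
    by linarith
qed

text \<open>Rotating \<open>z\<close> by \<open>cis (2 * pi * x)\<close> multiplies the
  \<open>k\<close>-th Taylor term by the character of frequency \<open>k\<close>. The powers are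
  written in \<open>(cmod z)\<^sup>2\<close>, the variable in which the moments are taken.\<close>

lemma circle_mean_square:
  assumes "f holomorphic_on UNIV"
  shows "(\<integral>\<^sup>+x. ennreal ((cmod (f (z * cis (2 * pi * x))))\<^sup>2) \<partial>unit_lborel) =
         (\<Sum>k. ennreal ((cmod (taylor_coeff f k))\<^sup>2) * ennreal (((cmod z)\<^sup>2) ^ k))"
proof -
  have "(\<Sum>k. taylor_coeff f k * z ^ k * cis (2 * pi * real k * x)) = f (z * cis (2 * pi * x))" for x
  proof -
    have "taylor_coeff f k * z ^ k * cis (2 * pi * real k * x) =
        taylor_coeff f k * (z * cis (2 * pi * x)) ^ k" for k
      by (simp add: power_mult_distrib Complex.DeMoivre mult_ac)
    then have "(\<lambda>k. taylor_coeff f k * z ^ k * cis (2 * pi * real k * x)) =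
        (\<lambda>k. taylor_coeff f k * (z * cis (2 * pi * x)) ^ k)"
      by (rule ext)
    then show ?thesis
      using taylor_sums[OF assms, of "z * cis (2 * pi * x)"] by (simp add: sums_iff)
  qed
  then show ?thesis
    using mean_square_trig_series[OF summable_norm_taylor[OF assms], of z]
    by (simp add: norm_mult norm_power power_mult_distrib ennreal_mult' flip: power_mult)
       (simp add: mult.commute)
qed

section \<open>Radial integrals over the plane\<close>

text \<open>
  Uniqueness of Haar measure: both sides equal the integral of
  \<open>indicator A x * indicator B (x + y)\<close> over \<open>M \<Otimes> lborel\<close>,
  because \<^const>\<open>lborel\<close> is also invariant under \<open>y \<mapsto> x - y\<close>.
\<close>

lemma translation_invariant_eq_lborel_mult:
  fixes M :: "'a::euclidean_space measure"
  assumes sM [measurable_cong]: "sets M = sets borel" and "sigma_finite_measure M"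
    and inv: "\<And>a. distr M borel ((+) a) = M"
    and [measurable]: "A \<in> sets borel" "B \<in> sets borel"
  shows "emeasure lborel B * emeasure M A = emeasure lborel A * emeasure M B"
proof -
  interpret M: sigma_finite_measure M by fact
  interpret P: pair_sigma_finite M "lborel :: 'a measure" ..
  have L: "(\<integral>\<^sup>+y. h (a + y) \<partial>lborel) = (\<integral>\<^sup>+y. h y \<partial>lborel)"
    if [measurable]: "h \<in> borel_measurable borel" for h :: "'a \<Rightarrow> ennreal" and a
    by (subst (2) lborel_distr_plus[of a, symmetric]) (simp add: nn_integral_distr)
  have L': "(\<integral>\<^sup>+y. h (a - y) \<partial>lborel) = (\<integral>\<^sup>+y. h y \<partial>lborel)"
    if [measurable]: "h \<in> borel_measurable borel" for h :: "'a \<Rightarrow> ennreal" and a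
    by (subst (2) lborel_affine[of "-1" a])
       (simp_all add: density_1 nn_integral_distr flip: one_ennreal_def)
  have I: "(\<integral>\<^sup>+y. h (a + y) \<partial>M) = (\<integral>\<^sup>+y. h y \<partial>M)"
    if [measurable]: "h \<in> borel_measurable borel" for h :: "'a \<Rightarrow> ennreal" and a
    by (subst (2) inv[of a, symmetric]) (simp add: nn_integral_distr)
  have "emeasure lborel B * emeasure M A =
      (\<integral>\<^sup>+x. (\<integral>\<^sup>+y. indicator A x * indicator B y \<partial>lborel) \<partial>M)"
    by (simp add: nn_integral_cmult nn_integral_multc mult.commute)
  also have "\<dots> = (\<integral>\<^sup>+x. (\<integral>\<^sup>+y. indicator A x * indicator B (x + y) \<partial>lborel) \<partial>M)"
  proof (rule nn_integral_cong)
    fix x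
    have "(\<integral>\<^sup>+y. indicator A x * indicator B (x + y) \<partial>lborel) =
      (\<integral>\<^sup>+y. indicator A x * indicator B y \<partial>lborel)"
      by (rule L[where h = "\<lambda>y. indicator A x * indicator B y"]) simp
    then show "(\<integral>\<^sup>+y. indicator A x * indicator B y \<partial>lborel) =
      (\<integral>\<^sup>+y. indicator A x * (indicator B (x + y) :: ennreal) \<partial>lborel)" ..
  qed
  also have "\<dots> = (\<integral>\<^sup>+y. (\<integral>\<^sup>+x. indicator A x * indicator B (x + y) \<partial>M) \<partial>lborel)"
    by (rule P.Fubini'[symmetric]) simp
  also have "\<dots> = (\<integral>\<^sup>+y. (\<integral>\<^sup>+x. indicator A (x - y) * indicator B x \<partial>M) \<partial>lborel)"
  proof (rule nn_integral_cong)
    fix y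
    have "(\<integral>\<^sup>+x. indicator A (y + x - y) * indicator B (y + x) \<partial>M) =
      (\<integral>\<^sup>+x. indicator A (x - y) * indicator B x \<partial>M)"
      by (rule I[where h = "\<lambda>x. indicator A (x - y) * indicator B x"]) simp
    then show "(\<integral>\<^sup>+x. indicator A x * indicator B (x + y) \<partial>M) =
      (\<integral>\<^sup>+x. indicator A (x - y) * indicator B x \<partial>M)"
      by (simp add: add.commute)
  qed
  also have "\<dots> = (\<integral>\<^sup>+x. (\<integral>\<^sup>+y. indicator A (x - y) * indicator B x \<partial>lborel) \<partial>M)"
    by (rule P.Fubini') simp
  also have "\<dots> = (\<integral>\<^sup>+x. (\<integral>\<^sup>+y. indicator A y * indicator B x \<partial>lborel) \<partial>M)"
  proof (rule nn_integral_cong)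
    fix x
    show "(\<integral>\<^sup>+y. indicator A (x - y) * indicator B x \<partial>lborel) =
      (\<integral>\<^sup>+y. indicator A y * indicator B x \<partial>lborel)"
      by (rule L'[where h = "\<lambda>y. indicator A y * indicator B x"]) simp
  qed
  also have "\<dots> = emeasure lborel A * emeasure M B"
    by (simp add: nn_integral_cmult nn_integral_multc)
  finally show ?thesis .
qed

text \<open>The rotated measure is again translation invariant, since rotating and then shifting by
  \<open>a\<close> equals shifting by \<open>a / c\<close> and then rotating. It is therefore a
  multiple of Lebesgue measure, and the unit disc, which the rotation preserves, shows that the
  factor is 1.\<close>

lemma lborel_distr_rotation:
  assumes c: "cmod c = 1"
  shows "distr lborel borel ((*) c) = (lborel :: complex measure)"
proof (rule measure_eqI)
  let ?M = "distr lborel borel ((*) c) :: complex measure"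
  have [simp]: "c \<noteq> 0" using c by auto
  have undo: "distr ?M borel ((*) (inverse c)) = lborel"
    by (subst distr_distr) (simp_all add: o_def distr_id2 flip: mult.assoc)
  \<comment> \<open>Sigma-finiteness passes back from the image under the inverse rotation, which is
    \<open>lborel\<close> by \<open>undo\<close>.\<close>
  have sf: "sigma_finite_measure ?M"
    by (rule sigma_finite_measure_distr[where N = borel and f = "(*) (inverse c)"])
       (simp_all add: undo lborel.sigma_finite_measure_axioms)
  have inv: "distr ?M borel ((+) a) = ?M" for a
  proof -
    have "distr ?M borel ((+) a) = distr (distr lborel borel ((+) (a / c))) borel ((*) c)"
      by (simp add: distr_distr o_def algebra_simps)
    then show ?thesis
      by (simp add: lborel_distr_plus)
  qed
  have "(*) c -` ball 0 1 = ball 0 1"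
    using c by (auto simp: norm_mult)
  then have ball: "emeasure ?M (ball 0 1) = emeasure lborel (ball 0 1 :: complex set)"
    by (simp add: emeasure_distr)
  fix A assume "A \<in> sets ?M"
  then have "emeasure lborel (ball 0 1 :: complex set) * emeasure ?M A =
      emeasure lborel (ball 0 1 :: complex set) * emeasure lborel A"
    using translation_invariant_eq_lborel_mult[OF _ sf inv, of A "ball 0 1"] ball
    by (simp add: mult.commute)
  moreover have "emeasure lborel (ball 0 1 :: complex set) = ennreal pi"
    by (simp add: emeasure_ball unit_ball_vol_2)
  ultimately show "emeasure ?M A = emeasure lborel A"
    using ennreal_mult_cancel_left[of "ennreal pi"] by simp
qed simp

text \<open>The preimage of a half-line \<open>{..a}\<close> with \<open>a \<ge> 0\<close> is a disc
  of area \<pi>a, and for negative \<open>a\<close> it is empty. Half-lines generate the Borel sets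
  and are stable under intersection.\<close>

lemma distr_cmod_square:
  "distr lborel borel (\<lambda>z::complex. (cmod z)\<^sup>2) =
     density lborel (\<lambda>t. ennreal pi * indicator {0..} t)"
proof -
  have vimage: "(\<lambda>z::complex. (cmod z)\<^sup>2) -` {..a} = cball 0 (sqrt a)" if "0 \<le> a" for a
    by (auto simp: real_le_rsqrt) (use that real_sqrt_pow2 power_mono norm_ge_zero in metis)
  show ?thesis
  proof (rule measure_eqI_generator_eq[where E = "range (\<lambda>a. {..a})" and \<Omega> = UNIV and
      A = "\<lambda>n. {..real n}"])
    show "Int_stable (range (atMost :: real \<Rightarrow> _))"
      by (auto simp: Int_stable_def)
    fix X :: "real set" assume "X \<in> range atMost"
    then obtain a where X: "X = {..a}" by blast
    show "emeasure (distr lborel borel (\<lambda>z::complex. (cmod z)\<^sup>2)) X =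
      emeasure (density lborel (\<lambda>t. ennreal pi * indicator {0..} t)) X"
    proof (cases "a \<ge> 0")
      case True
      have "emeasure (distr lborel borel (\<lambda>z::complex. (cmod z)\<^sup>2)) X = ennreal (pi * a)"
        using True by (simp add: X emeasure_distr vimage emeasure_cball unit_ball_vol_2)
      moreover have "(\<integral>\<^sup>+ x. ennreal pi * indicator {0..} x * indicator {..a} x \<partial>lborel) =
        (\<integral>\<^sup>+ x. ennreal pi * indicator {0..a} x \<partial>lborel)"
        by (intro nn_integral_cong) (auto split: split_indicator)
      ultimately show ?thesis
        using True by (simp add: X emeasure_density nn_integral_cmult ennreal_mult)
    next
      case False
      then have "(\<lambda>z::complex. (cmod z)\<^sup>2) -` {..a} = {}"
        by (auto simp: not_le dest: order_trans[OF zero_le_power2])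
      moreover have "(\<integral>\<^sup>+ x. ennreal pi * indicator {0..} x * indicator {..a} x \<partial>lborel) =
        (\<integral>\<^sup>+ x. 0 \<partial>(lborel::real measure))"
        using False by (intro nn_integral_cong) (auto split: split_indicator)
      ultimately show ?thesis
        by (simp add: X emeasure_distr emeasure_density)
    qed
  next
    show "(\<Union>i::nat. {..real i}) = UNIV"
      using real_arch_simple by auto
    show "emeasure (distr lborel borel (\<lambda>z::complex. (cmod z)\<^sup>2)) {..real i} \<noteq> \<infinity>" for i
      by (simp add: emeasure_distr vimage emeasure_cball)
    show "sets (distr lborel borel (\<lambda>z::complex. (cmod z)\<^sup>2)) = sigma_sets UNIV (range (\<lambda>a. {..a}))"
      "sets (density lborel (\<lambda>t::real. ennreal pi * indicator {0..} t)) = sigma_sets UNIV (range (\<lambda>a. {..a}))"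
      by (simp_all add: borel_eq_atMost)
  qed auto
qed

lemma nn_integral_radial:
  assumes [measurable]: "h \<in> borel_measurable borel"
  shows "(\<integral>\<^sup>+z. h ((cmod (z::complex))\<^sup>2) \<partial>lborel) = ennreal pi * (\<integral>\<^sup>+t\<in>{0..}. h t \<partial>lborel)"
proof -
  have "(\<integral>\<^sup>+z. h ((cmod (z::complex))\<^sup>2) \<partial>lborel) =
     (\<integral>\<^sup>+t. h t \<partial>distr lborel borel (\<lambda>z::complex. (cmod z)\<^sup>2))"
    by (simp add: nn_integral_distr)
  also have "\<dots> = (\<integral>\<^sup>+t. ennreal pi * (h t * indicator {0..} t) \<partial>lborel)"
    by (simp add: distr_cmod_square nn_integral_density mult_ac)
  finally show ?thesis
    by (simp add: nn_integral_cmult)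
qed

text \<open>The integral of \<open>h\<close> rotated by a fixed \<open>x\<close> does not depend on
  \<open>x\<close>; averaging over \<open>x\<close> and applying Tonelli's theorem gives the
  claim.\<close>

lemma nn_integral_rotation_average:
  assumes [measurable]: "h \<in> borel_measurable borel"
  shows "(\<integral>\<^sup>+z. h z \<partial>lborel) =
     (\<integral>\<^sup>+z. (\<integral>\<^sup>+x. h (z * cis (2 * pi * x)) \<partial>unit_lborel) \<partial>lborel)"
proof -
  interpret P: pair_sigma_finite unit_lborel "lborel :: complex measure" ..
  have rot: "(\<integral>\<^sup>+z. h (z * cis (2 * pi * x)) \<partial>lborel) = (\<integral>\<^sup>+z. h z \<partial>lborel)" for x
    by (subst (2) lborel_distr_rotation[of "cis (2 * pi * x)", symmetric])
       (simp_all add: nn_integral_distr mult.commute)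
  have [measurable]: "(\<lambda>x. x) \<in> unit_lborel \<rightarrow>\<^sub>M borel"
    by (rule measurable_restrict_space1) simp
  have [measurable]: "(\<lambda>x. cis (2 * pi * x)) \<in> borel_measurable borel"
    by (intro borel_measurable_continuous_onI continuous_intros)
  have "(\<integral>\<^sup>+z. h z \<partial>lborel) = (\<integral>\<^sup>+x. (\<integral>\<^sup>+z. h (z * cis (2 * pi * x)) \<partial>lborel) \<partial>unit_lborel)"
    using unit_lborel.emeasure_space_1 by (simp add: rot)
  also have "\<dots> = (\<integral>\<^sup>+z. (\<integral>\<^sup>+x. h (z * cis (2 * pi * x)) \<partial>unit_lborel) \<partial>lborel)"
    by (rule P.Fubini'[symmetric]) measurable
  finally show ?thesis .
qed

lemma borel_measurable_entire:
  assumes "f holomorphic_on UNIV"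
  shows "f \<in> borel_measurable borel"
  by (intro borel_measurable_continuous_onI holomorphic_on_imp_continuous_on assms)

text \<open>On each circle the factor \<open>V\<close> is constant, so averaging over rotations
  brings in Parseval's identity. The substitution t = |z|^2 then turns each power into a moment of
  \<open>V\<close>.\<close>

lemma nn_integral_cmod_square_radial:
  assumes f: "f holomorphic_on UNIV" and V [measurable]: "V \<in> borel_measurable borel"
  shows "(\<integral>\<^sup>+z. ennreal ((cmod (f z))\<^sup>2) * V ((cmod z)\<^sup>2) \<partial>lborel) =
     ennreal pi * (\<Sum>k. ennreal ((cmod (taylor_coeff f k))\<^sup>2) *
       (\<integral>\<^sup>+t\<in>{0..}. ennreal (t ^ k) * V t \<partial>lborel))"
proof -
  note [measurable] = borel_measurable_entire[OF f]
  have [measurable]: "(\<lambda>x. cis (2 * pi * x)) \<in> borel_measurable borel"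
    by (intro borel_measurable_continuous_onI continuous_intros)
  define c where "c = (\<lambda>k. ennreal ((cmod (taylor_coeff f k))\<^sup>2))"
  have mean: "(\<integral>\<^sup>+x. ennreal ((cmod (f (z * cis (2 * pi * x))))\<^sup>2) *
        V ((cmod (z * cis (2 * pi * x)))\<^sup>2) \<partial>unit_lborel) =
      (\<Sum>k. c k * ennreal (((cmod z)\<^sup>2) ^ k)) * V ((cmod z)\<^sup>2)" for z
  proof -
    have "(\<lambda>x. ennreal ((cmod (f (z * cis (2 * pi * x))))\<^sup>2)) \<in> borel_measurable unit_lborel"
      by (rule measurable_restrict_space1) measurable
    then show ?thesis
      by (simp add: norm_mult nn_integral_multc circle_mean_square[OF f] c_def)
  qed
  have "(\<integral>\<^sup>+z. ennreal ((cmod (f z))\<^sup>2) * V ((cmod z)\<^sup>2) \<partial>lborel) =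
      (\<integral>\<^sup>+z. (\<integral>\<^sup>+x. ennreal ((cmod (f (z * cis (2 * pi * x))))\<^sup>2) *
        V ((cmod (z * cis (2 * pi * x)))\<^sup>2) \<partial>unit_lborel) \<partial>lborel)"
    by (rule nn_integral_rotation_average) measurable
  also have "\<dots> = (\<integral>\<^sup>+z. (\<Sum>k. c k * ennreal (((cmod (z::complex))\<^sup>2) ^ k)) * V ((cmod z)\<^sup>2) \<partial>lborel)"
    by (simp only: mean)
  also have "\<dots> = ennreal pi * (\<integral>\<^sup>+t\<in>{0..}. (\<Sum>k. c k * ennreal (t ^ k)) * V t \<partial>lborel)"
    by (rule nn_integral_radial) measurable
  also have "(\<integral>\<^sup>+t\<in>{0..}. (\<Sum>k. c k * ennreal (t ^ k)) * V t \<partial>lborel) =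
      (\<integral>\<^sup>+t. (\<Sum>k. c k * (ennreal (t ^ k) * V t * indicator {0..} t)) \<partial>lborel)"
    by (simp add: mult_ac flip: ennreal_suminf_multc ennreal_suminf_cmult)
  also have "\<dots> = (\<Sum>k. c k * (\<integral>\<^sup>+t\<in>{0..}. ennreal (t ^ k) * V t \<partial>lborel))"
    by (simp add: nn_integral_suminf nn_integral_cmult)
  finally show ?thesis
    by (simp add: c_def)
qed

section \<open>Schwarz--Pick at infinity\<close>

text \<open>The singularities of \<open>f / g\<close> are zeros of \<open>g\<close>; boundedness
  makes them removable.\<close>

lemma bounded_quotient_extension:
  assumes f: "f holomorphic_on S" and g: "g holomorphic_on S"
    and S: "open S" "connected S"
    and le: "\<And>z. z \<in> S \<Longrightarrow> cmod (f z) \<le> cmod (g z)"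
    and nz: "\<exists>z\<in>S. g z \<noteq> 0"
  obtains h where "h holomorphic_on S" "\<And>z. z \<in> S \<Longrightarrow> cmod (h z) \<le> 1"
    "\<And>z. z \<in> S \<Longrightarrow> f z = h z * g z"
proof -
  define q where "q = (\<lambda>z. f z / g z)"
  have ana: "f analytic_on S" "g analytic_on S"
    using f g S by (auto simp: analytic_on_open)
  have mero: "q meromorphic_on S"
    unfolding q_def by (intro meromorphic_on_divide analytic_on_imp_meromorphic_on ana)
  \<comment> \<open>At a zero of \<open>g\<close> this holds because division by zero yields
    0.\<close>
  have q1: "cmod (q z) \<le> 1" if "z \<in> S" for z
    using le[OF that] by (auto simp: q_def norm_divide divide_le_eq_1)
  have ev1: "eventually (\<lambda>w. cmod (q w) \<le> 1) (at z)" if "z \<in> S" for z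
    using eventually_at_in_open'[OF S(1) that] by eventually_elim (rule q1)
  define h where "h = remove_sings q"
  have lim: "q \<midarrow>z\<rightarrow> h z" and an: "h analytic_on {z}" if z: "z \<in> S" for z
  proof -
    have mz: "q meromorphic_on {z}"
      by (rule meromorphic_on_subset[OF mero]) (use z in auto)
    have np: "\<not> is_pole q z"
    proof
      assume "is_pole q z"
      then have "eventually (\<lambda>w. cmod (q w) \<ge> 2) (at z)"
        unfolding is_pole_def filterlim_at_infinity[OF order_refl]
        by (elim allE[of _ 2]) auto
      with ev1[OF z] have "eventually (\<lambda>w. False) (at z)"
        by eventually_elim auto
      then show False by simp
    qed
    have "not_essential q z"
      using mz by (simp add: meromorphic_on_not_essential)
    then obtain c where c: "q \<midarrow>z\<rightarrow> c"
      using np unfolding not_essential_def by blast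
    then show "q \<midarrow>z\<rightarrow> h z"
      unfolding h_def by (metis remove_sings_eqI)
    have "isolated_singularity_at q z"
      using mz by (simp add: meromorphic_on_isolated_singularity)
    then show "h analytic_on {z}"
      unfolding h_def using c by (rule remove_sings_analytic_at)
  qed
  have hol: "h holomorphic_on S"
    using an analytic_on_analytic_at analytic_imp_holomorphic by blast
  have h1: "cmod (h z) \<le> 1" if "z \<in> S" for z
    using tendsto_norm[OF lim[OF that]] ev1[OF that]
    by (intro tendsto_upperbound) auto
  have fz: "f z = h z * g z" if z: "z \<in> S" for z
  proof -
    \<comment> \<open>As \<open>S\<close> is connected and \<open>g\<close> is not identically zero
      on it, the zeros of \<open>g\<close> are isolated. Hence \<open>q * g = f\<close> in a
      punctured neighbourhood of \<open>z\<close>, and the limit gives the equation at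
      \<open>z\<close> itself.\<close>
    obtain w where w: "w \<in> S" "g w \<noteq> 0" using nz by blast
    have "eventually (\<lambda>x. g x \<noteq> 0) (at z)"
      using non_zero_neighbour_alt[OF g S z w] by (auto elim: eventually_mono)
    then have "eventually (\<lambda>x. q x * g x = f x) (at z)"
      by eventually_elim (simp add: q_def)
    moreover have "isCont f z" "isCont g z"
      using z ana analytic_at_imp_isCont analytic_on_analytic_at by blast+
    then have "f \<midarrow>z\<rightarrow> f z" "(\<lambda>x. q x * g x) \<midarrow>z\<rightarrow> h z * g z"
      using lim[OF z] by (auto intro!: tendsto_intros simp: isCont_def)
    ultimately show ?thesis
      by (intro LIM_unique[OF _ Lim_transform_eventually])
  qed
  show thesis
    using that[OF hol h1 fz] by blast
qed

text \<open>Schwarz's lemma applied to \<open>p\<close>, the composition of \<open>k\<close> with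
  the disc automorphism that sends \<open>k 0\<close> to 0. The denominator is multiplied out so
  that unimodular constants are covered too.\<close>

lemma Schwarz_Pick_at_0:
  assumes k: "k holomorphic_on ball 0 1" and le: "\<And>z. cmod z < 1 \<Longrightarrow> cmod (k z) \<le> 1"
    and z: "cmod z < 1"
  shows "cmod (k z - k 0) \<le> cmod z * cmod (1 - cnj (k 0) * k z)"
proof (cases "\<exists>w. cmod w < 1 \<and> cmod (k w) = 1")
  case True
  then obtain w where w: "cmod w < 1" "cmod (k w) = 1" by blast
  \<comment> \<open>If the modulus 1 is attained inside the disc, the maximum principle makes
    \<open>k\<close> constant and the left-hand side 0.\<close>
  have "k constant_on ball 0 1"
    by (rule maximum_modulus_principle[OF k, where U = "ball 0 1" and \<xi> = w])
       (use w le in auto)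
  then have "k z = k 0"
    using z by (auto simp: constant_on_def)
  then show ?thesis by simp
next
  case False
  then have lt: "cmod (k w) < 1" if "cmod w < 1" for w
    using le[OF that] that by force
  define a where "a = k 0"
  have a: "cmod a < 1" using lt[of 0] by (simp add: a_def)
  have ne: "1 - cnj a * k w \<noteq> 0" if "cmod w < 1" for w
  proof
    assume "1 - cnj a * k w = 0"
    then have "cmod (cnj a * k w) = 1" by simp
    moreover have "cmod a * cmod (k w) < 1 * 1"
      using a lt[OF that] by (intro mult_strict_mono') auto
    ultimately show False by (simp add: norm_mult)
  qed
  define p where "p = (\<lambda>w. (k w - a) / (1 - cnj a * k w))"
  have "p holomorphic_on ball 0 1"
    unfolding p_def using ne by (intro holomorphic_intros k) auto
  moreover have "p 0 = 0" by (simp add: p_def a_def)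
  moreover have "cmod (p w) < 1" if "cmod w < 1" for w
  proof -
    \<comment> \<open>The standard identity showing that the automorphism preserves the open
      disc.\<close>
    have "(cmod (1 - cnj a * k w))\<^sup>2 - (cmod (k w - a))\<^sup>2 = (1 - (cmod a)\<^sup>2) * (1 - (cmod (k w))\<^sup>2)"
      unfolding cmod_power2 by (simp add: algebra_simps power2_eq_square)
    moreover have "(1 - (cmod a)\<^sup>2) * (1 - (cmod (k w))\<^sup>2) > 0"
      using a lt[OF that] by (intro mult_pos_pos) (auto simp: power_less_one_iff)
    ultimately have "(cmod (k w - a))\<^sup>2 < (cmod (1 - cnj a * k w))\<^sup>2"
      by linarith
    then have "cmod (k w - a) < cmod (1 - cnj a * k w)"
      by (rule power_less_imp_less_base) simp
    then show ?thesis
      using ne[OF that] by (simp add: p_def norm_divide)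
  qed
  ultimately have "cmod (p z) \<le> cmod z"
    by (rule Schwarz_Lemma(1)[OF _ _ _ z])
  then show ?thesis
    using ne[OF z] by (simp add: p_def norm_divide a_def divide_le_eq)
qed

text \<open>The number \<open>a\<close> is the value of \<open>f / g\<close> at infinity.
  Schwarz--Pick there gains a factor R/|z| over the domination assumed.\<close>

lemma domination_improvement:
  assumes f: "f holomorphic_on UNIV" and g: "g holomorphic_on UNIV" and R: "0 < R"
    and le: "\<And>z. R < cmod z \<Longrightarrow> cmod (f z) \<le> cmod (g z)"
  obtains a where "cmod a \<le> 1"
    "\<And>z. R \<le> cmod z \<Longrightarrow> cmod z * cmod (f z - a * g z) \<le> R * cmod (g z - cnj a * f z)"
proof -
  let ?S = "{z::complex. R < cmod z}"
  have "\<exists>a. cmod a \<le> 1 \<and>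
    (\<forall>z. R < cmod z \<longrightarrow> cmod z * cmod (f z - a * g z) \<le> R * cmod (g z - cnj a * f z))"
  proof (cases "\<exists>z\<in>?S. g z \<noteq> 0")
    case False
    \<comment> \<open>Here \<open>g\<close>, and with it \<open>f\<close>, vanishes for |z| > R, so
      \<open>a = 0\<close> will do.\<close>
    then show ?thesis using le by (intro exI[of _ 0]) fastforce
  next
    case True
    have "open ?S"
      by (intro open_Collect_less continuous_intros)
    moreover have "connected ?S"
      using connected_complement_bounded_convex[of "cball (0::complex) R"]
      by (simp add: Compl_eq Collect_neg_eq not_le)
    moreover have "f holomorphic_on ?S" "g holomorphic_on ?S"
      using f g holomorphic_on_subset by blast+
    ultimately obtain h where h: "h holomorphic_on ?S" "\<And>z. z \<in> ?S \<Longrightarrow> cmod (h z) \<le> 1"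
      "\<And>z. z \<in> ?S \<Longrightarrow> f z = h z * g z"
      using bounded_quotient_extension[of f ?S g] le True by auto
    \<comment> \<open>The inversion w = R/z exchanges the exterior with the punctured unit disc and
      moves infinity to 0, where boundedness makes the singularity removable.\<close>
    define k0 where "k0 = (\<lambda>w. h (of_real R / w))"
    have in_S: "of_real R / w \<in> ?S" if "w \<in> ball 0 1 - {0}" for w
      using that R by (auto simp: norm_divide less_divide_eq)
    have "k0 holomorphic_on (ball 0 1 - {0})"
      unfolding k0_def
      by (rule holomorphic_on_compose_gen[OF _ h(1), unfolded o_def])
         (use in_S in \<open>auto intro!: holomorphic_intros\<close>)
    moreover have "eventually (\<lambda>w. cmod (k0 w) \<le> 1) (at 0)"
    proof -
      have "eventually (\<lambda>w::complex. w \<in> ball 0 1 - {0}) (at 0)"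
        by (intro eventually_at_in_open) auto
      then show ?thesis
        by eventually_elim (use h(2) in_S in \<open>auto simp: k0_def\<close>)
    qed
    ultimately have "\<exists>k. k holomorphic_on ball 0 1 \<and> (\<forall>w\<in>ball 0 1 - {0}. k w = k0 w)"
      by (subst holomorphic_on_extend_bounded) (auto simp: interior_open)
    then obtain k where k: "k holomorphic_on ball 0 1"
        "\<And>w. w \<in> ball 0 1 - {0} \<Longrightarrow> k w = k0 w"
      by blast
    have k1': "cmod (k w) \<le> 1" if "w \<in> ball 0 1 - {0}" for w
      using k(2)[OF that] h(2)[OF in_S[OF that]] by (simp add: k0_def)
    have "isCont k 0"
      using holomorphic_on_imp_continuous_on[OF k(1)] by (simp add: continuous_on_eq_continuous_at)
    then have "((\<lambda>w. cmod (k w)) \<longlongrightarrow> cmod (k 0)) (at 0)"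
      by (intro tendsto_norm) (simp add: isCont_def)
    moreover have "eventually (\<lambda>w. cmod (k w) \<le> 1) (at 0)"
      using k1' by (intro eventually_mono[OF eventually_at_in_open[of "ball 0 1"]]) auto
    ultimately have "cmod (k 0) \<le> 1"
      by (intro tendsto_upperbound) auto
    then have k1: "cmod (k w) \<le> 1" if "cmod w < 1" for w
      using k1'[of w] that by (cases "w = 0") auto
    show ?thesis
    proof (intro exI[of _ "k 0"] conjI allI impI k1)
      fix z assume z: "R < cmod z"
      define w where "w = of_real R / z"
      have w: "cmod w < 1" "w \<noteq> 0" "cmod z * cmod w = R" "of_real R / w = z"
        using z R by (auto simp: w_def norm_divide divide_less_eq)
      then have kw: "k w = h z"
        using k(2)[of w] by (simp add: k0_def)
      have fz: "f z = h z * g z"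
        using h(3) z by simp
      \<comment> \<open>The wanted inequality is Schwarz--Pick at \<open>w\<close> multiplied by |z|
        |g(z)|, because |z| |w| = R.\<close>
      have "f z - k 0 * g z = (k w - k 0) * g z"
        "g z - cnj (k 0) * f z = (1 - cnj (k 0) * k w) * g z"
        by (simp_all add: fz kw algebra_simps)
      moreover have "cmod z * (cmod (k w - k 0) * cmod (g z)) \<le>
          cmod z * (cmod w * cmod (1 - cnj (k 0) * k w) * cmod (g z))"
        using Schwarz_Pick_at_0[OF k(1) k1 w(1)] by (intro mult_left_mono mult_right_mono) auto
      ultimately show "cmod z * cmod (f z - k 0 * g z) \<le> R * cmod (g z - cnj (k 0) * f z)"
        by (simp only: norm_mult w(3)[symmetric] mult.assoc)
    qed simp
  qed
  then obtain a where a: "cmod a \<le> 1"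
    "\<And>z. R < cmod z \<Longrightarrow> cmod z * cmod (f z - a * g z) \<le> R * cmod (g z - cnj a * f z)"
    by blast
  have cont: "continuous_on UNIV f" "continuous_on UNIV g"
    using f g by (auto intro: holomorphic_on_imp_continuous_on)
  \<comment> \<open>Continuity along the ray through \<open>z\<close>, as t decreases to 1, adds the
    circle |z| = R. It is included because \<nu> may have an atom at
    \<open>R\<^sup>2\<close>.\<close>
  have "cmod z * cmod (f z - a * g z) \<le> R * cmod (g z - cnj a * f z)" if z: "R \<le> cmod z" for z
  proof -
    let ?d = "\<lambda>t::real. R * cmod (g (t * z) - cnj a * f (t * z)) -
      cmod (t * z) * cmod (f (t * z) - a * g (t * z))"
    have "continuous_on UNIV ?d"
      by (intro continuous_intros continuous_on_compose2[OF cont(1)] continuous_on_compose2[OF cont(2)]) auto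
    then have "isCont ?d 1"
      by (simp add: continuous_on_eq_continuous_at)
    then have "(?d \<longlongrightarrow> ?d 1) (at_right 1)"
      by (simp add: isCont_def filterlim_at_split)
    moreover have "eventually (\<lambda>t. 0 \<le> ?d t) (at_right 1)"
      unfolding eventually_at_right_field
    proof (intro exI[of _ 2] conjI allI impI)
      fix t :: real assume "1 < t" "t < 2"
      then have "R < cmod (t * z)"
        using z R by (simp add: norm_mult) (smt (verit) mult_less_cancel_right1)
      then show "0 \<le> ?d t" using a(2) by auto
    qed simp
    ultimately have "0 \<le> ?d 1"
      by (intro tendsto_lowerbound) auto
    then show ?thesis by simp
  qed
  then show thesis using that a(1) by blast
qed

section \<open>Comparison of weighted square sums\<close>

text \<open>For the moments of \<open>W\<close> and \<open>f\<close> in the Fock space this is the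
  squared norm of \<open>f\<close>.\<close>

definition weighted_square_sum :: "(nat \<Rightarrow> ennreal) \<Rightarrow> (complex \<Rightarrow> complex) \<Rightarrow> ennreal" where
  "weighted_square_sum m f = (\<Sum>k. ennreal ((cmod (taylor_coeff f k))\<^sup>2) * m k)"

text \<open>\<open>W\<close> is only Lebesgue measurable, so it is cut off to [0,\<infinity>) and
  replaced by a Borel function \<open>V\<close> that agrees with it almost everywhere; the radial
  formula then applies to \<open>V\<close>.\<close>

lemma nn_integral_fock:
  assumes W: "radial_weight W" and f: "f holomorphic_on UNIV"
  shows "(\<integral>\<^sup>+z. ennreal ((cmod (f z))\<^sup>2 * W ((cmod z)\<^sup>2)) \<partial>lebesgue) =
     ennreal pi * weighted_square_sum (\<lambda>k. ennreal (weight_moment W k)) f"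
proof -
  have "(\<lambda>t. ennreal (W t) * indicator {0..} t) \<in> borel_measurable lebesgue"
    using W by (subst borel_measurable_restrict_space_iff_ennreal[symmetric])
      (auto simp: radial_weight_def)
  from completion_ex_borel_measurable[OF this]
  obtain V where V [measurable]: "V \<in> borel_measurable borel"
    and eq: "AE t in lborel. ennreal (W t) * indicator {0..} t = V t"
    by auto
  have moment: "ennreal (weight_moment W k) = (\<integral>\<^sup>+t\<in>{0..}. ennreal (t ^ k) * V t \<partial>lborel)" for k
  proof -
    have "ennreal (weight_moment W k) = (\<integral>\<^sup>+t. ennreal (t ^ k * W t) \<partial>lebesgue_on {0..})"
      unfolding weight_moment_def using W
      by (intro nn_integral_eq_integral[symmetric])
        (auto simp: radial_weight_def AE_restrict_space_iff)
    also have "\<dots> = (\<integral>\<^sup>+t\<in>{0..}. ennreal (t ^ k * W t) \<partial>lborel)"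
      by (simp add: nn_integral_restrict_space nn_integral_completion)
    also have "\<dots> = (\<integral>\<^sup>+t\<in>{0..}. ennreal (t ^ k) * V t \<partial>lborel)"
      using eq by (intro nn_integral_cong_AE)
        (auto elim!: eventually_mono simp: ennreal_mult' split: split_indicator_asm split_indicator)
    finally show ?thesis .
  qed
  \<comment> \<open>The image of area measure under |z|^2 has a density, so null sets on the line
    pull back to null sets in the plane.\<close>
  have "AE t in distr lborel borel (\<lambda>z::complex. (cmod z)\<^sup>2). ennreal (W t) * indicator {0..} t = V t"
    unfolding distr_cmod_square using eq by (subst AE_density) auto
  then have "AE z::complex in lborel. ennreal (W ((cmod z)\<^sup>2)) * indicator {0..} ((cmod z)\<^sup>2) = V ((cmod z)\<^sup>2)"
    by (rule AE_distrD[rotated]) simp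
  then have "(\<integral>\<^sup>+z. ennreal ((cmod (f z))\<^sup>2 * W ((cmod z)\<^sup>2)) \<partial>lborel) =
      (\<integral>\<^sup>+z. ennreal ((cmod (f z))\<^sup>2) * V ((cmod z)\<^sup>2) \<partial>lborel)"
    by (intro nn_integral_cong_AE) (auto elim!: eventually_mono simp: ennreal_mult')
  then show ?thesis
    by (simp add: nn_integral_completion nn_integral_cmod_square_radial[OF f V] moment
        weighted_square_sum_def)
qed

lemma weighted_square_sum_fock:
  assumes W: "radial_weight W" and f: "f \<in> fock_space W"
  shows "weighted_square_sum (\<lambda>k. ennreal (weight_moment W k)) f = ennreal ((fock_norm W f)\<^sup>2)"
proof -
  let ?I = "LINT z|lebesgue. (cmod (f z))\<^sup>2 * W ((cmod z)\<^sup>2)"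
  have nn: "0 \<le> (cmod (f z))\<^sup>2 * W ((cmod z)\<^sup>2)" for z
    using W by (simp add: radial_weight_def)
  then have I: "0 \<le> ?I" by (simp add: integral_nonneg)
  have "ennreal ?I = ennreal pi * weighted_square_sum (\<lambda>k. ennreal (weight_moment W k)) f"
    using f nn nn_integral_fock[OF W, of f]
    by (subst nn_integral_eq_integral[symmetric]) (auto simp: fock_space_def)
  then have "ennreal (1 / pi) * ennreal ?I =
      ennreal (1 / pi) * ennreal pi * weighted_square_sum (\<lambda>k. ennreal (weight_moment W k)) f"
    by (simp add: mult.assoc)
  then show ?thesis
    using I by (simp add: fock_norm_def flip: ennreal_mult)
qed

lemma suminf_ennreal_split_head: "(\<Sum>k. h k) = h 0 + (\<Sum>k. h (Suc k))"
  for h :: "nat \<Rightarrow> ennreal"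
  using sums_unique[OF sums_Suc[OF summable_sums[OF summableI, of "\<lambda>k. h (Suc k)"]]]
  by (simp add: add.commute)

text \<open>The inequality between \<open>v\<close> and \<open>u\<close>, squared and averaged over
  the circle |z|^2 = t, becomes a comparison of power series in \<open>t\<close>, which is
  integrated against \<nu>.\<close>

lemma weighted_square_sum_le:
  assumes u: "u holomorphic_on UNIV" and v: "v holomorphic_on UNIV" and R: "0 < R"
    and le: "\<And>z. R \<le> cmod z \<Longrightarrow> cmod z * cmod (v z) \<le> R * cmod (u z)"
    and sets [measurable_cong]: "sets \<nu> = sets borel" and "prob_space \<nu>"
    and supp: "emeasure \<nu> {..<R\<^sup>2} = 0"
    and m0: "m 0 = 1"
    and m: "\<And>k. m (Suc k) \<le> measure_moment \<nu> (Suc k)"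
      "\<And>k. ennreal (R\<^sup>2) * measure_moment \<nu> k \<le> m (Suc k)"
  shows "weighted_square_sum m v \<le> weighted_square_sum m u"
proof -
  interpret prob_space \<nu> by fact
  define a where "a = (\<lambda>k. ennreal ((cmod (taylor_coeff v k))\<^sup>2))"
  define b where "b = (\<lambda>k. ennreal ((cmod (taylor_coeff u k))\<^sup>2))"
  \<comment> \<open>The factor R^2/t lowers each power of \<open>t\<close> by one. For k = 0 this
    would leave a moment of order -1, so there the factor is bounded by 1.\<close>
  have pw: "(\<Sum>k. a k * ennreal (t ^ k)) \<le> b 0 + (\<Sum>k. b (Suc k) * (ennreal (R\<^sup>2) * ennreal (t ^ k)))"
    if t: "R\<^sup>2 \<le> t" for t
  proof -
    have tpos: "0 < t" using t R by (smt (verit) zero_less_power)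
    define z where "z = complex_of_real (sqrt t)"
    have z: "(cmod z)\<^sup>2 = t" using tpos by (simp add: z_def)
    have Rz: "R \<le> cmod z" using t R tpos by (simp add: z_def real_le_rsqrt)
    have "(\<Sum>k. a k * ennreal (t ^ k)) =
        (\<integral>\<^sup>+x. ennreal ((cmod (v (z * cis (2 * pi * x))))\<^sup>2) \<partial>unit_lborel)"
      unfolding circle_mean_square[OF v] z a_def ..
    also have "\<dots> \<le> (\<integral>\<^sup>+x. ennreal (R\<^sup>2 / t) * ennreal ((cmod (u (z * cis (2 * pi * x))))\<^sup>2) \<partial>unit_lborel)"
    proof (rule nn_integral_mono)
      fix x
      let ?w = "z * cis (2 * pi * x)"
      have w: "cmod ?w = cmod z" by (simp add: norm_mult)
      have "(cmod ?w * cmod (v ?w))\<^sup>2 \<le> (R * cmod (u ?w))\<^sup>2"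
        using le[of ?w] Rz w by (intro power_mono) auto
      then have "t * (cmod (v ?w))\<^sup>2 \<le> R\<^sup>2 * (cmod (u ?w))\<^sup>2"
        by (simp only: power_mult_distrib w z)
      then have "(cmod (v ?w))\<^sup>2 \<le> R\<^sup>2 / t * (cmod (u ?w))\<^sup>2"
        using tpos by (simp add: field_simps)
      then show "ennreal ((cmod (v ?w))\<^sup>2) \<le> ennreal (R\<^sup>2 / t) * ennreal ((cmod (u ?w))\<^sup>2)"
        using tpos by (simp add: ennreal_leI flip: ennreal_mult)
    qed
    also have "\<dots> = ennreal (R\<^sup>2 / t) * (\<Sum>k. b k * ennreal (t ^ k))"
    proof -
      note [measurable] = borel_measurable_entire[OF u]
      have [measurable]: "(\<lambda>x. cis (2 * pi * x)) \<in> borel_measurable borel"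
        by (intro borel_measurable_continuous_onI continuous_intros)
      have "(\<lambda>x. ennreal ((cmod (u (z * cis (2 * pi * x))))\<^sup>2)) \<in> borel_measurable unit_lborel"
        by (rule measurable_restrict_space1) measurable
      then show ?thesis
        by (simp add: nn_integral_cmult circle_mean_square[OF u] z b_def)
    qed
    also have "\<dots> = ennreal (R\<^sup>2 / t) * b 0 +
        (\<Sum>k. b (Suc k) * (ennreal (R\<^sup>2 / t) * ennreal (t ^ Suc k)))"
      by (subst suminf_ennreal_split_head)
        (simp add: distrib_left mult_ac del: power_Suc flip: ennreal_suminf_cmult)
    also have "ennreal (R\<^sup>2 / t) * b 0 \<le> b 0"
    proof -
      have "ennreal (R\<^sup>2 / t) \<le> 1"
        using t tpos by (simp add: divide_le_eq_1)
      then show ?thesis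
        using mult_right_mono[of "ennreal (R\<^sup>2 / t)" 1 "b 0"] by simp
    qed
    also have "(\<lambda>k. ennreal (R\<^sup>2 / t) * ennreal (t ^ Suc k)) = (\<lambda>k. ennreal (R\<^sup>2) * ennreal (t ^ k))"
      using tpos by (simp flip: ennreal_mult)
    finally show ?thesis by (simp add: add_mono)
  qed
  have "weighted_square_sum m v \<le> (\<Sum>k. a k * measure_moment \<nu> k)"
    unfolding weighted_square_sum_def a_def
  proof (intro suminf_le mult_left_mono summableI zero_le)
    \<comment> \<open>For k = 0 both sides are 1, as \<nu> has total mass 1.\<close>
    fix k show "m k \<le> measure_moment \<nu> k"
      using m(1) m0 by (cases k) (simp_all add: measure_moment_def emeasure_space_1)
  qed
  also have "\<dots> = (\<integral>\<^sup>+t. (\<Sum>k. a k * ennreal (t ^ k)) \<partial>\<nu>)"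
    by (simp add: nn_integral_suminf nn_integral_cmult measure_moment_def)
  also have "\<dots> \<le> (\<integral>\<^sup>+t. b 0 + (\<Sum>k. b (Suc k) * (ennreal (R\<^sup>2) * ennreal (t ^ k))) \<partial>\<nu>)"
  proof (rule nn_integral_mono_AE)
    have "AE t in \<nu>. t \<notin> {..<R\<^sup>2}"
      using supp by (intro AE_not_in null_setsI) auto
    then show "AE t in \<nu>. (\<Sum>k. a k * ennreal (t ^ k)) \<le>
        b 0 + (\<Sum>k. b (Suc k) * (ennreal (R\<^sup>2) * ennreal (t ^ k)))"
      by eventually_elim (rule pw, simp)
  qed
  also have "\<dots> = b 0 + (\<Sum>k. b (Suc k) * (ennreal (R\<^sup>2) * measure_moment \<nu> k))"
    by (simp add: nn_integral_add nn_integral_suminf nn_integral_cmult measure_moment_def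
        emeasure_space_1)
  also have "\<dots> \<le> b 0 * m 0 + (\<Sum>k. b (Suc k) * m (Suc k))"
    by (intro add_mono suminf_le mult_left_mono m(2) summableI zero_le) (simp add: m0)
  also have "\<dots> = weighted_square_sum m u"
    unfolding weighted_square_sum_def b_def by (subst (2) suminf_ennreal_split_head) simp
  finally show ?thesis .
qed

section \<open>The linear change from \<open>f\<close>, \<open>g\<close> to \<open>v\<close>,
  \<open>u\<close>\<close>

lemma taylor_coeff_diff_cmult:
  assumes "f holomorphic_on UNIV" "g holomorphic_on UNIV"
  shows "taylor_coeff (\<lambda>z. f z - a * g z) k = taylor_coeff f k - a * taylor_coeff g k"
proof -
  have "(deriv ^^ k) (\<lambda>z. f z - a * g z) 0 = (deriv ^^ k) f 0 - a * (deriv ^^ k) g 0"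
    using assms by (subst higher_deriv_diff[of _ UNIV])
      (auto intro!: holomorphic_intros simp: higher_deriv_cmult[of _ UNIV])
  then show ?thesis
    by (simp add: taylor_coeff_def diff_divide_distrib)
qed

text \<open>The identity |v|^2 - |u|^2 = (1-|a|^2)(|f|^2 - |g|^2), applied to each Taylor
  coefficient. Terms are moved across so that no subtraction of \<open>ennreal\<close> values
  occurs.\<close>

lemma weighted_square_sum_Moebius:
  fixes a :: complex
  assumes f: "f holomorphic_on UNIV" and g: "g holomorphic_on UNIV" and a: "cmod a \<le> 1"
  defines "u \<equiv> \<lambda>z. g z - cnj a * f z" and "v \<equiv> \<lambda>z. f z - a * g z"
  shows "weighted_square_sum m v + ennreal (1 - (cmod a)\<^sup>2) * weighted_square_sum m g =
         weighted_square_sum m u + ennreal (1 - (cmod a)\<^sup>2) * weighted_square_sum m f"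
proof -
  have a1: "0 \<le> 1 - (cmod a)\<^sup>2" using a by (simp add: power_le_one)
  have "(cmod (x - a * y))\<^sup>2 + (1 - (cmod a)\<^sup>2) * (cmod y)\<^sup>2 =
      (cmod (y - cnj a * x))\<^sup>2 + (1 - (cmod a)\<^sup>2) * (cmod x)\<^sup>2" for x y
    unfolding cmod_power2 by (simp add: algebra_simps power2_eq_square)
  then have "ennreal ((cmod (x - a * y))\<^sup>2) + ennreal (1 - (cmod a)\<^sup>2) * ennreal ((cmod y)\<^sup>2) =
      ennreal ((cmod (y - cnj a * x))\<^sup>2) + ennreal (1 - (cmod a)\<^sup>2) * ennreal ((cmod x)\<^sup>2)" for x y
    using a1 by (simp flip: ennreal_mult ennreal_plus)
  then show ?thesis
    unfolding weighted_square_sum_def u_def v_def taylor_coeff_diff_cmult[OF f g]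
      taylor_coeff_diff_cmult[OF g f]
    by (simp add: suminf_add[OF summableI summableI] flip: ennreal_suminf_cmult mult.assoc distrib_right)
qed

text \<open>Finiteness is what permits cancelling the sum of \<open>u\<close> in the final
  comparison. It follows from |x - ay|^2 \<le> 2|x|^2 + 2|a|^2 |y|^2.\<close>

lemma weighted_square_sum_diff_finite:
  assumes f: "f holomorphic_on UNIV" and g: "g holomorphic_on UNIV"
    and fin: "weighted_square_sum m f < \<infinity>" "weighted_square_sum m g < \<infinity>"
  shows "weighted_square_sum m (\<lambda>z. f z - a * g z) < \<infinity>"
proof -
  have "weighted_square_sum m (\<lambda>z. f z - a * g z) \<le>
      (\<Sum>k. 2 * (ennreal ((cmod (taylor_coeff f k))\<^sup>2) * m k) +
        ennreal (2 * (cmod a)\<^sup>2) * (ennreal ((cmod (taylor_coeff g k))\<^sup>2) * m k))"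
    unfolding weighted_square_sum_def taylor_coeff_diff_cmult[OF f g]
  proof (intro suminf_le summableI)
    fix k
    let ?x = "taylor_coeff f k" and ?y = "taylor_coeff g k"
    have "(cmod (?x - a * ?y))\<^sup>2 \<le> (cmod ?x + cmod a * cmod ?y)\<^sup>2"
      using norm_triangle_ineq4[of ?x "a * ?y"] by (intro power_mono) (auto simp: norm_mult)
    also have "\<dots> \<le> 2 * (cmod ?x)\<^sup>2 + 2 * (cmod a)\<^sup>2 * (cmod ?y)\<^sup>2"
      using sum_squares_bound[of "cmod ?x" "cmod a * cmod ?y"]
      by (simp add: power2_sum power_mult_distrib)
    finally have "ennreal ((cmod (?x - a * ?y))\<^sup>2) \<le>
        ennreal (2 * (cmod ?x)\<^sup>2 + 2 * (cmod a)\<^sup>2 * (cmod ?y)\<^sup>2)"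
      by (rule ennreal_leI)
    also have "\<dots> = 2 * ennreal ((cmod ?x)\<^sup>2) + ennreal (2 * (cmod a)\<^sup>2) * ennreal ((cmod ?y)\<^sup>2)"
      by (simp add: ennreal_mult)
    finally show "ennreal ((cmod (?x - a * ?y))\<^sup>2) * m k \<le>
        2 * (ennreal ((cmod ?x)\<^sup>2) * m k) + ennreal (2 * (cmod a)\<^sup>2) * (ennreal ((cmod ?y)\<^sup>2) * m k)"
      unfolding mult.assoc[symmetric] distrib_right[symmetric] by (rule mult_right_mono) simp
  qed
  also have "\<dots> = 2 * weighted_square_sum m f + ennreal (2 * (cmod a)\<^sup>2) * weighted_square_sum m g"
    by (simp add: weighted_square_sum_def suminf_add[OF summableI summableI, symmetric])
  also have "\<dots> < \<infinity>"
    using fin by (simp add: ennreal_mult_less_top)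
  finally show ?thesis .
qed

section \<open>Admissibility from the comparison of \<open>v\<close> and \<open>u\<close>\<close>

theorem theorem1p2:
  fixes W :: "real \<Rightarrow> real" and R :: real
  assumes "radial_weight W"
    and "weight_moment W 0 = 1"
    and "0 < R"
    and "\<exists>\<nu> :: real measure.
           sets \<nu> = sets borel \<and> prob_space \<nu> \<and> emeasure \<nu> {..<R\<^sup>2} = 0 \<and>
           (\<forall>k\<ge>1. ennreal (weight_moment W k) \<le> measure_moment \<nu> k \<and>
                   ennreal (R\<^sup>2) * measure_moment \<nu> (k - 1) \<le> ennreal (weight_moment W k))"
  shows "admissible_radius W R"
  unfolding admissible_radius_def
proof (intro conjI ballI impI assms(3))
  fix f g assume fg: "f \<in> fock_space W" "g \<in> fock_space W"
    and le: "\<forall>z. R < cmod z \<longrightarrow> cmod (f z) \<le> cmod (g z)"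
  have hol: "f holomorphic_on UNIV" "g holomorphic_on UNIV"
    using fg by (auto simp: fock_space_def)
  obtain a where a: "cmod a \<le> 1"
    "\<And>z. R \<le> cmod z \<Longrightarrow> cmod z * cmod (f z - a * g z) \<le> R * cmod (g z - cnj a * f z)"
    using domination_improvement[OF hol assms(3)] le by blast
  let ?u = "\<lambda>z. g z - cnj a * f z" and ?v = "\<lambda>z. f z - a * g z"
  let ?N = "weighted_square_sum (\<lambda>k. ennreal (weight_moment W k))"
  have huv: "?u holomorphic_on UNIV" "?v holomorphic_on UNIV"
    using hol by (auto intro!: holomorphic_intros)
  show "fock_norm W f \<le> fock_norm W g"
  proof (cases "cmod a = 1")
    case True
    \<comment> \<open>When |a| = 1 the factor 1-|a|^2 degenerates, but then v = -au, so |z| |v|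
      \<le> R |v| forces v = 0 outside the disc. The identity theorem extends this to the plane, and
      |f| = |g| everywhere.\<close>
    have v0: "f z - a * g z = 0" if z: "R < cmod z" for z
    proof -
      have "a * cnj a = 1" using True by (simp flip: complex_norm_square)
      then have "f z - a * g z = - a * (g z - cnj a * f z)"
        by (simp add: algebra_simps)
      then have "cmod (f z - a * g z) = cmod (g z - cnj a * f z)"
        using True by (simp only: norm_mult norm_minus_cancel mult_1_left)
      then have "(cmod z - R) * cmod (f z - a * g z) \<le> 0"
        using a(2)[of z] z by (simp add: algebra_simps)
      then show ?thesis using z by (simp add: mult_le_0_iff)
    qed
    have op: "open {z. R < cmod z}"
      by (intro open_Collect_less continuous_intros)
    have "f z - a * g z = 0" for z
    proof (rule analytic_continuation[OF huv(2), of "{z. R < cmod z}" "of_real (R + 1)"])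
      show "complex_of_real (R + 1) islimpt {z. R < cmod z}"
        using assms(3) by (intro open_imp_islimpt op) (simp flip: of_real_add del: of_real_add)
    qed (use v0 in auto)
    then have "f z = a * g z" for z by (simp add: algebra_simps)
    then have "cmod (f z) = cmod (g z)" for z using True by (simp add: norm_mult)
    then show ?thesis by (simp add: fock_norm_def)
  next
    case False
    then have c: "0 < 1 - (cmod a)\<^sup>2"
      using a(1) by (simp add: power_less_one_iff)
    obtain \<nu> where \<nu>: "sets \<nu> = sets borel" "prob_space \<nu>" "emeasure \<nu> {..<R\<^sup>2} = 0"
      and m: "\<And>k. k \<ge> 1 \<Longrightarrow> ennreal (weight_moment W k) \<le> measure_moment \<nu> k"
        "\<And>k. k \<ge> 1 \<Longrightarrow> ennreal (R\<^sup>2) * measure_moment \<nu> (k - 1) \<le> ennreal (weight_moment W k)"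
      using assms(4) by blast
    \<comment> \<open>The hypotheses for k \<ge> 1 are used at \<open>Suc k\<close>, where
      \<open>k - 1\<close> becomes the lower index.\<close>
    have vu: "?N ?v \<le> ?N ?u"
      by (rule weighted_square_sum_le[OF huv assms(3) a(2) \<nu>])
        (use m m(2)[of "Suc _"] assms(2) in auto)
    have "?N f < \<infinity>" "?N g < \<infinity>"
      using fg assms(1) by (simp_all add: weighted_square_sum_fock)
    then have fin: "?N ?u < \<infinity>"
      by (intro weighted_square_sum_diff_finite hol)
    \<comment> \<open>Replacing \<open>?N ?v\<close> by the larger \<open>?N ?u\<close> leaves a
      common finite summand; cancelling it and the positive factor compares the norms.\<close>
    have "?N ?u + ennreal (1 - (cmod a)\<^sup>2) * ?N f = ?N ?v + ennreal (1 - (cmod a)\<^sup>2) * ?N g"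
      by (rule weighted_square_sum_Moebius[OF hol a(1), symmetric])
    also have "\<dots> \<le> ?N ?u + ennreal (1 - (cmod a)\<^sup>2) * ?N g"
      using vu by (rule add_right_mono)
    finally have "ennreal (1 - (cmod a)\<^sup>2) * ?N f \<le> ennreal (1 - (cmod a)\<^sup>2) * ?N g"
      using fin by (auto simp: ennreal_add_left_cancel_le)
    then have "(1 - (cmod a)\<^sup>2) * (fock_norm W f)\<^sup>2 \<le> (1 - (cmod a)\<^sup>2) * (fock_norm W g)\<^sup>2"
      using c fg assms(1) by (simp add: weighted_square_sum_fock flip: ennreal_mult)
    then have "(fock_norm W f)\<^sup>2 \<le> (fock_norm W g)\<^sup>2"
      using c by simp
    moreover have "0 \<le> fock_norm W g"
      using assms(1) by (simp add: fock_norm_def radial_weight_def integral_nonneg)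
    ultimately show ?thesis
      by (rule power2_le_imp_le)
  qed
qed

end
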